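(* Let $p,d,N$ be positive integers with $d<p$ and $N>p$. Let $\mathcal{R}\in\mathbb{R}^{p\times N}$ have singular values $\sigma_1\ge\sigma_2\ge\cdots\ge\sigma_d>\sigma_{d+1}\ge\cdots\ge\sigma_p$. Let $\mathcal{U}_d\in\mathbb{R}^{p\times d}$ be the matrix whose columns are the $d$ leading principal components $\mathrm{PC}_1,\dots,\mathrm{PC}_d$ of $\mathcal{R}$. Let $U_0\in\mathbb{R}^{p\times d}$ satisfy $\operatorname{rank}(U_0^T\mathcal{U}_d)=d$, and let $(U_k^{LS})_{k\ge0}$ be the iterates of the iterative least-squares algorithm applied to $\mathcal{R}$, initialized with $U_0^{LS}=U_0$. Then $$\lim_{k\to\infty}\operatorname{Col}(U_k^{LS})=\operatorname{Col}(\mathcal{U}_d),$$ and for every $\varepsilon>0$ the rate of convergence is $O\!\left(\left(\frac{\sigma_{d+1}^2}{\sigma_d^2}+\varepsilon\right)^k\right)$; that is, for every $\varepsilon>0$, the distance between $\operatorname{Col}(U_k^{LS})$ and $\operatorname{Col}(\mathcal{U}_d)$ is $O\!\left(\left(\frac{\sigma_{d+1}^2}{\sigma_d^2}+\varepsilon\right)^k\right)$ as $k\to\infty$.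
   Context: $\operatorname{Col}(M)$ is the column space of a matrix $M$; $\|\cdot\|$ is the Euclidean norm and $\|\cdot\|_F$ the Frobenius norm. The singular values $\sigma_1\ge\dots\ge\sigma_p\ge 0$ of $\mathcal{R}\in\mathbb{R}^{p\times N}$ are the square roots of the eigenvalues of $\mathcal{R}\mathcal{R}^T$, with multiplicity. Distance between subspaces $S,T\subset\mathbb{R}^p$ is $\|P_S-P_T\|$, the operator norm of the difference of the orthogonal projections onto $S$ and $T$; convergence of subspaces is with respect to this distance. Principal components of $\mathcal{R}$: $\mathrm{PC}_1$ is a maximizer of $\|w^T\mathcal{R}\|^2$ over unit vectors $w\in\mathbb{R}^p$, and for $k>1$, $\mathrm{PC}_k$ is a maximizer of $\|w^T\mathcal{R}\|^2$ over unit vectors $w$ orthogonal to $\operatorname{span}\{\mathrm{PC}_1,\dots,\mathrm{PC}_{k-1}\}$. Equivalently, $\mathrm{PC}_1,\dots,\mathrm{PC}_p$ is an orthonormal basis of eigenvectors of $\mathcal{R}\mathcal{R}^T$ with eigenvalues $\sigma_1^2\ge\dots\ge\sigma_p^2$ respectively (any choice is allowed when eigenvalues are repeated). For $A\in\mathbb{R}^{p\times d}$, $\mathrm{GS}(A)\in\mathbb{R}^{p\times d}$ denotes the result of the (normalized) Gram–Schmidt process on the columns of $A$; its columns span $\operatorname{Col}(A)$, and they are orthonormal when the columns of $A$ are linearly independent. Iterative least-squares algorithm for $\mathcal{R}$ (run without a stopping rule): given $U_k$, set $X_k=U_k^T\mathcal{R}\in\mathbb{R}^{d\times N}$; let $A_{k+1}$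 be a minimizer of $\|\mathcal{R}-AX_k\|_F^2$ over $A\in\mathbb{R}^{p\times d}$ (equivalently, a solution of $A X_kX_k^T=\mathcal{R}X_k^T$); set $U_{k+1}=\mathrm{GS}(A_{k+1})$. *)

theory Defs
  imports "HOL-Analysis.Analysis" "HOL-Library.Landau_Symbols"
begin

text \<open>
  A real matrix with rows indexed by \<open>'p\<close> and columns by \<open>'d\<close> has type \<^typ>\<open>real^'d^'p\<close>.
  Where the order of the columns matters (principal components, Gram--Schmidt), the column index
  type is a finite linear order, whose elements play the role of \<open>1, \<dots>, d\<close>.
  The norm of the type \<^typ>\<open>real^'d^'p\<close> is the Frobenius norm:
\<close>

lemma norm_matrix_eq_frobenius:
  fixes A :: "real^'d^'p"
  shows "norm A = sqrt (\<Sum>i\<in>UNIV. \<Sum>j\<in>UNIV. (A $ i $ j)\<^sup>2)"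
  by (simp add: norm_vec_def L2_set_def sum_nonneg)

definition col_space :: "real^'d^'p \<Rightarrow> (real^'p) set" where
  "col_space A = span (columns A)"

definition orth_proj :: "(real^'p) set \<Rightarrow> real^'p \<Rightarrow> real^'p" where
  "orth_proj S x = (THE y. y \<in> S \<and> (\<forall>z\<in>S. orthogonal (x - y) z))"

lemma orth_proj_ex1:
  fixes S :: "(real^'p) set"
  assumes "subspace S"
  shows "\<exists>!y. y \<in> S \<and> (\<forall>z\<in>S. orthogonal (x - y) z)"
proof (rule ex_ex1I)
  obtain y z where "y \<in> span S" "\<And>w. w \<in> span S \<Longrightarrow> orthogonal z w" "x = y + z"
    using orthogonal_subspace_decomp_exists by blast
  then show "\<exists>y. y \<in> S \<and> (\<forall>z\<in>S. orthogonal (x - y) z)"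
    using assms by (intro exI[of _ y]) (simp add: span_eq_iff[THEN iffD2])
next
  fix y y'
  assume y: "y \<in> S \<and> (\<forall>z\<in>S. orthogonal (x - y) z)"
    and y': "y' \<in> S \<and> (\<forall>z\<in>S. orthogonal (x - y') z)"
  then have "y - y' \<in> S"
    using assms by (simp add: subspace_diff)
  with y y' have "orthogonal ((x - y') - (x - y)) (y - y')"
    by (meson orthogonal_clauses)
  then show "y = y'"
    by (simp add: orthogonal_def)
qed

definition subspace_dist :: "(real^'p) set \<Rightarrow> (real^'p) set \<Rightarrow> real" where
  "subspace_dist S T = onorm (\<lambda>x. orth_proj S x - orth_proj T x)"

text \<open>
  The singular values are indexed from \<open>1\<close> to \<open>p\<close>; values of \<open>\<sigma>\<close> outside this range are irrelevant.
  As \<open>R R\<^sup>T\<close> is symmetric, the multiplicity of an eigenvalue is the dimension of its eigenspace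
  (which is \<open>0\<close> for a number that is not an eigenvalue).
\<close>

definition eigenspace :: "real^'p^'p \<Rightarrow> real \<Rightarrow> (real^'p) set" where
  "eigenspace A \<mu> = {v. A *v v = \<mu> *\<^sub>R v}"

definition has_singular_values :: "real^'n^'p \<Rightarrow> (nat \<Rightarrow> real) \<Rightarrow> bool" where
  "has_singular_values R \<sigma> \<longleftrightarrow>
     antimono_on {1..CARD('p)} \<sigma> \<and>
     (\<forall>i\<in>{1..CARD('p)}. 0 \<le> \<sigma> i) \<and>
     (\<forall>\<mu>. card {i \<in> {1..CARD('p)}. (\<sigma> i)\<^sup>2 = \<mu>} = dim (eigenspace (R ** transpose R) \<mu>))"

text \<open>
  The columns of \<open>W\<close>, in order, are some choice of leading principal components of \<open>R\<close>.
\<close>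

definition leading_pcs :: "real^'n^'p \<Rightarrow> real^('d::{finite,linorder})^'p \<Rightarrow> bool" where
  "leading_pcs R W \<longleftrightarrow>
     (\<forall>i. is_arg_max (\<lambda>w. (norm (w v* R))\<^sup>2)
            (\<lambda>w. norm w = 1 \<and> (\<forall>v \<in> span {column j W |j. j < i}. orthogonal w v))
            (column i W))"

text \<open>
  Normalization is by \<^const>\<open>sgn\<close>, i.e. division by the norm with the zero vector sent to itself: a
  column that depends linearly on its predecessors becomes \<open>0\<close>, so the span is preserved.
\<close>

function gs_col :: "real^('d::{finite,linorder})^'p \<Rightarrow> 'd \<Rightarrow> real^'p" where
  "gs_col A i = sgn (column i A - (\<Sum>j | j < i. (column i A \<bullet> gs_col A j) *\<^sub>R gs_col A j))"
  by auto
termination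
  by (relation "Wellfounded.measure (\<lambda>(A, i). card {j. j < i})")
    (auto intro!: psubset_card_mono)

declare gs_col.simps [simp del]

definition gram_schmidt :: "real^('d::{finite,linorder})^'p \<Rightarrow> real^('d::{finite,linorder})^'p" where
  "gram_schmidt A = (\<chi> r i. gs_col A i $ r)"

text \<open>
  The minimizer in a step need not be unique; the sequence may use any of them.
\<close>

definition ls_step ::
  "real^'n^'p \<Rightarrow> real^('d::{finite,linorder})^'p \<Rightarrow> real^('d::{finite,linorder})^'p \<Rightarrow> bool" where
  "ls_step R U U' \<longleftrightarrow>
     (let X = transpose U ** R in
      \<exists>A. is_arg_min (\<lambda>B. (norm (R - B ** X))\<^sup>2) (\<lambda>_. True) A \<and> U' = gram_schmidt A)"

definition ls_iterates ::
  "real^'n^'p \<Rightarrow> real^('d::{finite,linorder})^'p \<Rightarrow> (nat \<Rightarrow> real^('d::{finite,linorder})^'p) \<Rightarrow> bool" where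
  "ls_iterates R U0 U \<longleftrightarrow> U 0 = U0 \<and> (\<forall>k. ls_step R (U k) (U (Suc k)))"

end

theory Submission
  imports Defs
begin

text \<open>
  The least-squares algorithm is subspace iteration in disguise. Put \<open>M = R R\<^sup>T\<close>. The normal
  equations of a step from \<open>U\<close> read \<open>A (U\<^sup>T M U) = M U\<close>; as long as \<open>U\<^sup>T M U\<close> is invertible,
  the new column space is therefore \<open>M\<close> applied to the old one, and Gram-Schmidt only changes the
  basis (\<open>col_space_ls_step\<close>).

  Let \<open>S\<close> be the span of the leading principal components. The multiplicities of the singular
  values provide an orthonormal eigenbasis of \<open>M\<close> (\<open>singular_values_eigenbasis\<close>), and because of
  the gap between \<open>\<sigma>\<^sub>d\<close> and \<open>\<sigma>\<^sub>d\<^sub>+\<^sub>1\<close> the greedy maximizers must lie in the span of its \<open>d\<close>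
  dominant vectors, so that \<open>S\<close> is this span
  (\<open>constrained_maximizer_in_dominant_eigenspace\<close>, \<open>col_space_leading_pcs\<close>). Thus
  \<open>M\<close> commutes with the projection onto \<open>S\<close>, stretches vectors of \<open>S\<close> by at least
  \<open>a = \<sigma>\<^sub>d\<^sup>2\<close>, and stretches vectors orthogonal to \<open>S\<close> by at most \<open>b = \<sigma>\<^sub>d\<^sub>+\<^sub>1\<^sup>2 < a\<close>.

  Consequently, if every vector of a subspace \<open>V\<close> has a component orthogonal to \<open>S\<close> of norm at most
  \<open>t\<close> times that of its component in \<open>S\<close>, the same holds for the image of \<open>V\<close> under \<open>M\<close> with
  \<open>t (b / a)\<close> instead of \<open>t\<close> (\<open>tilt_le_image\<close>). The rank condition on \<open>U\<^sub>0\<close> supplies a finite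
  \<open>t\<close> to start with, and for subspaces of equal dimension the distance is at most \<open>2 t\<close>
  (\<open>subspace_dist_le_tilt\<close>). So the distance after \<open>k\<close> steps is at most a constant times
  \<open>(b / a)\<^sup>k\<close>, which gives both the limit and the rate.
\<close>

section \<open>Orthogonal projections\<close>

lemma orth_proj_mem: "subspace S \<Longrightarrow> orth_proj S x \<in> S"
  and orth_proj_residual: "subspace S \<Longrightarrow> z \<in> S \<Longrightarrow> (x - orth_proj S x) \<bullet> z = 0"
  using theI'[OF orth_proj_ex1, of S x] unfolding orth_proj_def orthogonal_def by auto

lemma orth_proj_unique:
  assumes "subspace S" "y \<in> S" "\<And>z. z \<in> S \<Longrightarrow> (x - y) \<bullet> z = 0"
  shows "orth_proj S x = y"
  using assms orth_proj_ex1[OF assms(1), of x] orth_proj_mem[of S x] orth_proj_residual[of S _ x]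
  unfolding orthogonal_def by blast

lemma linear_orth_proj:
  fixes S :: "(real^'p) set"
  assumes "subspace S"
  shows "linear (orth_proj S)"
proof (rule linearI)
  fix x y :: "real^'p" and c :: real
  show "orth_proj S (x + y) = orth_proj S x + orth_proj S y"
  proof (rule orth_proj_unique[OF assms])
    fix z assume "z \<in> S"
    then have "(x - orth_proj S x) \<bullet> z = 0" "(y - orth_proj S y) \<bullet> z = 0"
      using assms by (auto intro: orth_proj_residual)
    then show "(x + y - (orth_proj S x + orth_proj S y)) \<bullet> z = 0"
      by (simp add: algebra_simps)
  qed (use assms in \<open>auto intro: subspace_add orth_proj_mem\<close>)
  show "orth_proj S (c *\<^sub>R x) = c *\<^sub>R orth_proj S x"
  proof (rule orth_proj_unique[OF assms])
    fix z assume "z \<in> S"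
    then show "(c *\<^sub>R x - c *\<^sub>R orth_proj S x) \<bullet> z = 0"
      using orth_proj_residual[OF assms, of z x] by (simp add: inner_diff_left)
  qed (use assms in \<open>auto intro: subspace_mul orth_proj_mem\<close>)
qed

lemma norm_orth_proj_le:
  assumes "subspace S"
  shows "norm (orth_proj S x) \<le> norm x"
proof -
  have "orth_proj S x \<bullet> orth_proj S x = x \<bullet> orth_proj S x"
    using orth_proj_residual[OF assms orth_proj_mem[OF assms], of x x] by (simp add: inner_diff_left)
  also have "\<dots> \<le> norm x * norm (orth_proj S x)"
    by (rule norm_cauchy_schwarz)
  finally have "norm (orth_proj S x) * norm (orth_proj S x) \<le> norm x * norm (orth_proj S x)"
    by (simp add: norm_eq_sqrt_inner)
  then show ?thesis
    by (cases "norm (orth_proj S x) = 0") (auto simp: mult_le_cancel_right)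
qed

lemma subspace_dist_nonneg:
  assumes "subspace S" "subspace T"
  shows "0 \<le> subspace_dist S T"
  unfolding subspace_dist_def
  by (intro onorm_pos_le) (simp add: linear_conv_bounded_linear[symmetric] assms linear_orth_proj linear_compose_sub)

section \<open>Subspaces close to a given subspace\<close>

text \<open>
  A bound on the tangent of the largest angle between a vector of \<open>V\<close> and the subspace \<open>S\<close>:
  \<open>V\<close> lies in the cone of opening \<open>t\<close> around \<open>S\<close>. Unlike the distance of subspaces, this quantity
  is tested vector by vector, so its behaviour under a linear map can be read off directly.
\<close>

definition tilt_le :: "(real^'p) set \<Rightarrow> (real^'p) set \<Rightarrow> real \<Rightarrow> bool" where
  "tilt_le S V t \<longleftrightarrow> (\<forall>v\<in>V. norm (v - orth_proj S v) \<le> t * norm (orth_proj S v))"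

lemma tilt_le_orth_proj_eq_0:
  assumes "tilt_le S V t" "v \<in> V" "orth_proj S v = 0"
  shows "v = 0"
  using assms unfolding tilt_le_def by force

text \<open>
  A vector in a cone around \<open>S\<close> whose projection vanishes is zero, so the projection is injective on
  \<open>V\<close>, and equality of dimensions makes it surjective. In other words, \<open>V\<close> is the graph of a linear
  map from \<open>S\<close> to its orthogonal complement.
\<close>

lemma tilt_le_orth_proj_surj:
  assumes S: "subspace S" and V: "subspace V" and "dim V = dim S" and t: "tilt_le S V t"
  shows "orth_proj S ` V = S"
proof (rule subspace_dim_equal)
  have lin: "linear (orth_proj S)" by (rule linear_orth_proj[OF S])
  show "subspace (orth_proj S ` V)" by (rule linear_subspace_image[OF lin V])
  show "orth_proj S ` V \<subseteq> S" using orth_proj_mem[OF S] by auto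
  have "inj_on (orth_proj S) V"
    using tilt_le_orth_proj_eq_0[OF t] linear_inj_on_iff_eq_0[OF lin V] by auto
  then have "dim (orth_proj S ` V) = dim V"
    using V by (intro dim_image_eq[OF lin]) (simp add: span_eq_iff[THEN iffD2])
  then show "dim S \<le> dim (orth_proj S ` V)" using assms by simp
qed (rule S)

text \<open>
  Write \<open>y\<close> for the projection of \<open>x\<close> onto \<open>V\<close>. The difference of the two projections of \<open>x\<close> is
  the part of \<open>y\<close> orthogonal to \<open>S\<close> minus the projection \<open>s\<close> of \<open>x - y\<close> onto \<open>S\<close>. The cone
  condition bounds the first term. For the second, lift \<open>s\<close> to some \<open>v \<in> V\<close>; since \<open>x - y\<close> is
  orthogonal to \<open>V\<close>, its inner product with \<open>s\<close> only sees \<open>s - v\<close>, which is again small by the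
  cone condition.
\<close>

lemma subspace_dist_le_tilt:
  fixes S V :: "(real^'p) set"
  assumes S: "subspace S" and V: "subspace V" and dim: "dim V = dim S" and t: "tilt_le S V t"
    and "0 \<le> t"
  shows "subspace_dist V S \<le> 2 * t"
  unfolding subspace_dist_def
proof (rule onorm_le)
  fix x :: "real^'p"
  define y where "y = orth_proj V x"
  define s where "s = orth_proj S (x - y)"
  have "norm (y - orth_proj S y) \<le> t * norm (orth_proj S y)"
    using t orth_proj_mem[OF V] by (auto simp: tilt_le_def y_def)
  also have "\<dots> \<le> t * norm x"
    using norm_orth_proj_le[OF S, of y] norm_orth_proj_le[OF V, of x] \<open>0 \<le> t\<close>
    by (intro mult_left_mono) (auto simp: y_def)
  finally have 1: "norm (y - orth_proj S y) \<le> t * norm x" .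
  have "s \<in> S" by (simp add: s_def orth_proj_mem[OF S])
  then have "s \<in> orth_proj S ` V"
    by (simp only: tilt_le_orth_proj_surj[OF S V dim t])
  then obtain v where v: "v \<in> V" "orth_proj S v = s"
    by auto
  have "s \<bullet> s = (x - y) \<bullet> s"
    using orth_proj_residual[OF S \<open>s \<in> S\<close>, of "x - y"] by (simp add: s_def inner_diff_left)
  also have "\<dots> = (x - y) \<bullet> (s - v)"
    using orth_proj_residual[OF V v(1), of x] by (simp add: y_def inner_diff_right)
  also have "\<dots> \<le> norm (x - y) * norm (s - v)"
    by (rule norm_cauchy_schwarz)
  also have "\<dots> \<le> norm x * (t * norm s)"
  proof (intro mult_mono)
    have "norm (x - y) ^ 2 + norm y ^ 2 = norm x ^ 2"
      using orth_proj_residual[OF V orth_proj_mem[OF V], of x x]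
      by (simp add: y_def power2_norm_eq_inner algebra_simps inner_commute)
    then show "norm (x - y) \<le> norm x"
      by (smt (verit) norm_ge_zero power2_le_imp_le zero_le_power2)
    show "norm (s - v) \<le> t * norm s"
      using t v by (auto simp: tilt_le_def norm_minus_commute)
  qed auto
  finally have "norm s * norm s \<le> (t * norm x) * norm s"
    by (simp add: norm_eq_sqrt_inner mult_ac)
  then have 2: "norm s \<le> t * norm x"
    using \<open>0 \<le> t\<close> by (cases "norm s = 0") (auto simp: mult_le_cancel_right)
  have "orth_proj V x - orth_proj S x = (y - orth_proj S y) - s"
    by (simp add: y_def s_def linear_diff[OF linear_orth_proj[OF S]])
  then show "norm (orth_proj V x - orth_proj S x) \<le> 2 * t * norm x"
    using 1 2 norm_triangle_ineq4[of "y - orth_proj S y" s] by simp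
qed

text \<open>
  A symmetric map that leaves \<open>S\<close> invariant also leaves the orthogonal complement of \<open>S\<close>
  invariant, so it preserves the orthogonal decomposition of a vector.
\<close>

lemma orth_proj_commute:
  assumes S: "subspace S" and f: "linear f" and "f ` S \<subseteq> S"
    and sym: "\<And>x y. f x \<bullet> y = x \<bullet> f y"
  shows "orth_proj S (f x) = f (orth_proj S x)"
proof (rule orth_proj_unique[OF S])
  show "f (orth_proj S x) \<in> S" using assms orth_proj_mem[OF S] by blast
  fix z assume "z \<in> S"
  then have "(x - orth_proj S x) \<bullet> f z = 0"
    using assms by (intro orth_proj_residual[OF S]) blast
  then show "(f x - f (orth_proj S x)) \<bullet> z = 0"
    by (simp add: sym flip: linear_diff[OF f])
qed

text \<open>
  The contraction behind the rate of convergence: \<open>f\<close> acts separately on the two components of a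
  vector, shrinking the one orthogonal to \<open>S\<close> relative to the one in \<open>S\<close> by a factor of at most
  \<open>b / a\<close>.
\<close>

lemma tilt_le_image:
  assumes S: "subspace S" and f: "linear f" 
    and com: "\<And>x. orth_proj S (f x) = f (orth_proj S x)"
    and lo: "\<And>x. x \<in> S \<Longrightarrow> a * norm x \<le> norm (f x)"
    and hi: "\<And>x. (\<And>z. z \<in> S \<Longrightarrow> x \<bullet> z = 0) \<Longrightarrow> norm (f x) \<le> b * norm x"
    and "0 < a" "0 \<le> b" "0 \<le> t" and t: "tilt_le S V t"
  shows "tilt_le S (f ` V) (t * (b / a))"
  unfolding tilt_le_def
proof clarify
  fix v assume "v \<in> V"
  have "norm (f v - orth_proj S (f v)) = norm (f (v - orth_proj S v))"
    by (simp add: com linear_diff[OF f])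
  also have "\<dots> \<le> b * norm (v - orth_proj S v)"
    by (intro hi) (simp add: orth_proj_residual[OF S])
  also have "\<dots> \<le> b * (t * norm (orth_proj S v))"
    using t \<open>v \<in> V\<close> \<open>0 \<le> b\<close> by (intro mult_left_mono) (auto simp: tilt_le_def)
  also have "\<dots> \<le> b * (t * (norm (f (orth_proj S v)) / a))"
    using lo[OF orth_proj_mem[OF S, of v]] \<open>0 < a\<close> \<open>0 \<le> b\<close> \<open>0 \<le> t\<close>
    by (intro mult_left_mono) (auto simp: field_simps)
  finally show "norm (f v - orth_proj S (f v)) \<le> t * (b / a) * norm (orth_proj S (f v))"
    by (simp add: com mult_ac)
qed

text \<open>
  A linear map that is injective on a finite-dimensional space is bounded below there, which turns
  the qualitative transversality of \<open>V\<close> to the complement of \<open>S\<close> into a cone condition.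
\<close>

lemma ex_tilt_le:
  assumes S: "subspace S" and V: "subspace V"
    and "\<And>v. v \<in> V \<Longrightarrow> orth_proj S v = 0 \<Longrightarrow> v = 0"
  obtains c where "0 \<le> c" "tilt_le S V c"
proof -
  have "bounded_linear (orth_proj S)"
    using linear_orth_proj[OF S] by (simp add: linear_conv_bounded_linear)
  then obtain e where e: "e > 0" "\<forall>x\<in>V. norm (orth_proj S x) \<ge> e * norm x"
    using injective_imp_isometric[OF closed_subspace[OF V] V] assms(3) by blast
  have "norm (v - orth_proj S v) \<le> (1 / e + 1) * norm (orth_proj S v)" if "v \<in> V" for v
  proof -
    have "norm v \<le> norm (orth_proj S v) / e"
      using e that by (simp add: field_simps)
    then show ?thesis
      using norm_triangle_ineq4[of v "orth_proj S v"] by (simp add: algebra_simps)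
  qed
  then show ?thesis
    using e by (intro that[of "1 / e + 1"]) (auto simp: tilt_le_def)
qed

section \<open>Column spaces and Gram-Schmidt\<close>

lemma col_space_eq_range: "col_space A = range ((*v) A)"
  for A :: "real^'d^'p"
proof
  show "range ((*v) A) \<subseteq> col_space A"
    by (auto simp: col_space_def matrix_vector_mult_in_columnspace)
  have "subspace (range ((*v) A))"
    by (intro linear_subspace_image) auto
  moreover have "columns A \<subseteq> range ((*v) A)"
    by (auto simp: columns_def simp flip: matrix_vector_mult_basis)
  ultimately show "col_space A \<subseteq> range ((*v) A)"
    unfolding col_space_def by (rule span_minimal[rotated])
qed

lemma subspace_col_space: "subspace (col_space A)"
  by (simp add: col_space_def)

lemma inj_iff_dim_col_space: "inj ((*v) A) \<longleftrightarrow> dim (col_space A) = CARD('d)"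
  for A :: "real^'d^'p"
  by (simp add: full_rank_injective[symmetric] column_rank_def col_space_def)

text \<open>
  Strong induction for finite linear orders, which need not be instances of the class
  \<^class>\<open>wellorder\<close>.
\<close>

lemma finite_linorder_less_induct:
  fixes i :: "'d::{finite,linorder}"
  assumes "\<And>i. (\<And>j. j < i \<Longrightarrow> P j) \<Longrightarrow> P i"
  shows "P i"
proof (induction "card {j. j < i}" arbitrary: i rule: less_induct)
  case less
  show ?case
  proof (rule assms)
    fix j assume "j < i"
    then have "{k. k < j} \<subset> {k. k < i}" by auto
    then show "P j" by (intro less) (simp add: psubset_card_mono)
  qed
qed

text \<open>
  Every new column is a combination of an old one and the preceding new ones, and conversely. This
  includes the columns that are sent to \<open>0\<close>, since a vector equals its norm times its
  \<^const>\<open>sgn\<close> even when it vanishes.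
\<close>

lemma col_space_gram_schmidt: "col_space (gram_schmidt A) = col_space A"
  for A :: "real^('d::{finite,linorder})^'p"
proof -
  have col: "column i (gram_schmidt A) = gs_col A i" for i
    by (simp add: column_def gram_schmidt_def vec_eq_iff)
  have *: "columns A = range (\<lambda>i. column i A)" "columns (gram_schmidt A) = range (gs_col A)"
    by (auto simp: columns_def col)
  have "gs_col A i \<in> col_space A" for i
  proof (induction i rule: finite_linorder_less_induct)
    case (1 i)
    have "column i A - (\<Sum>j | j < i. (column i A \<bullet> gs_col A j) *\<^sub>R gs_col A j) \<in> col_space A"
      using 1 unfolding col_space_def
      by (intro span_diff span_sum span_mul) (auto simp: * intro: span_base)
    then show ?case
      by (subst gs_col.simps) (auto simp: sgn_div_norm intro: subspace_mul subspace_col_space)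
  qed
  moreover have "column i A \<in> col_space (gram_schmidt A)" for i
  proof -
    define w where "w = column i A - (\<Sum>j | j < i. (column i A \<bullet> gs_col A j) *\<^sub>R gs_col A j)"
    have "w = norm w *\<^sub>R sgn w"
      by (cases "w = 0") (auto simp: sgn_div_norm)
    also have "sgn w = gs_col A i"
      by (subst gs_col.simps) (simp add: w_def)
    finally have "w = norm w *\<^sub>R gs_col A i" .
    then have "w \<in> col_space (gram_schmidt A)"
      unfolding col_space_def by (metis * rangeI span_base span_mul)
    moreover have "(\<Sum>j | j < i. (column i A \<bullet> gs_col A j) *\<^sub>R gs_col A j) \<in> col_space (gram_schmidt A)"
      unfolding col_space_def by (intro span_sum span_mul span_base) (auto simp: *)
    ultimately have "w + (\<Sum>j | j < i. (column i A \<bullet> gs_col A j) *\<^sub>R gs_col A j) \<in> col_space (gram_schmidt A)"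
      by (rule subspace_add[OF subspace_col_space])
    then show ?thesis by (simp add: w_def)
  qed
  ultimately show ?thesis
    unfolding col_space_def
    by (intro subset_antisym span_minimal subspace_span) (auto simp: *)
qed

section \<open>The least-squares step\<close>

lemma inner_matrix_mult_right: "Y \<bullet> (D ** X) = (Y ** transpose X) \<bullet> D"
  for Y :: "real^'n^'p" and D :: "real^'d^'p" and X :: "real^'n^'d"
proof -
  have "(\<Sum>j\<in>UNIV. Y$i$j * (\<Sum>k\<in>UNIV. D$i$k * X$k$j)) = (\<Sum>k\<in>UNIV. (\<Sum>j\<in>UNIV. Y$i$j * X$k$j) * D$i$k)" for i
    by (simp add: sum_distrib_left sum_distrib_right mult_ac sum.swap[of _ "UNIV::'n set"])
  then show ?thesis
    by (simp add: inner_vec_def matrix_matrix_mult_def transpose_def)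
qed

text \<open>
  Subtracting from \<open>y\<close> its component along \<open>z\<close> lowers the squared norm by
  \<open>(y \<bullet> z)\<^sup>2 / (z \<bullet> z)\<close>.
\<close>

lemma minimal_norm_imp_inner_0:
  fixes y z :: "'a::real_inner"
  assumes "\<And>t. norm y \<le> norm (y - t *\<^sub>R z)"
  shows "y \<bullet> z = 0"
proof (rule ccontr)
  assume nz: "y \<bullet> z \<noteq> 0"
  then have z: "z \<bullet> z > 0" by auto
  define t where "t = (y \<bullet> z) / (z \<bullet> z)"
  have "y \<bullet> y \<le> (y - t *\<^sub>R z) \<bullet> (y - t *\<^sub>R z)"
    using assms[of t] by (simp add: norm_eq_sqrt_inner)
  also have "\<dots> = y \<bullet> y - (y \<bullet> z)\<^sup>2 / (z \<bullet> z)"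
    using z by (simp add: t_def algebra_simps inner_commute power2_eq_square)
  finally show False
    using nz z by (simp add: divide_le_0_iff not_le)
qed

lemma matrix_diff_rdistrib: "(A - B) ** C = A ** C - B ** C"
  for A B :: "real^'n^'m" and C :: "real^'k^'n"
  by (simp add: matrix_matrix_mult_def vec_eq_iff algebra_simps sum_subtractf)

text \<open>
  The residual \<open>Y = R - A ** X\<close> is orthogonal to every direction \<open>D ** X\<close> in which the model can
  vary; choosing \<open>D = Y ** transpose X\<close> makes the inner product the squared norm of \<open>D\<close>.
\<close>

lemma least_squares_normal_equation:
  fixes R :: "real^'n^'p" and X :: "real^'n^'d"
  assumes "is_arg_min (\<lambda>B. (norm (R - B ** X))\<^sup>2) (\<lambda>_. True) A"
  shows "A ** (X ** transpose X) = R ** transpose X"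
proof -
  define Y where "Y = R - A ** X"
  define D where "D = Y ** transpose X"
  have "Y \<bullet> (D ** X) = 0"
  proof (rule minimal_norm_imp_inner_0)
    fix t
    have "(norm Y)\<^sup>2 \<le> (norm (R - (A + t *\<^sub>R D) ** X))\<^sup>2"
      using assms by (auto simp: is_arg_min_linorder Y_def)
    also have "R - (A + t *\<^sub>R D) ** X = Y - t *\<^sub>R (D ** X)"
      by (simp add: Y_def matrix_matrix_mult_def vec_eq_iff algebra_simps sum.distrib sum_distrib_left)
    finally show "norm Y \<le> norm (Y - t *\<^sub>R (D ** X))"
      by (rule power2_le_imp_le) simp
  qed
  then have "D = 0"
    by (simp add: inner_matrix_mult_right flip: D_def)
  then show ?thesis
    by (simp add: D_def Y_def matrix_diff_rdistrib matrix_mul_assoc)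
qed

text \<open>
  One least-squares step is one step of subspace iteration with \<open>R R\<^sup>T\<close>. The normal equations read
  \<open>A G = (R R\<^sup>T) U\<close> with the Gram matrix \<open>G = X X\<^sup>T\<close>. Once \<open>G\<close> is invertible, \<open>A\<close> has the same
  range as \<open>(R R\<^sup>T) U\<close>, and Gram-Schmidt does not change that range.
\<close>

lemma col_space_ls_step:
  fixes R :: "real^'n^'p" and U U' :: "real^('d::{finite,linorder})^'p"
  assumes "ls_step R U U'"
    and nz: "\<And>y. (R ** transpose R) *v (U *v y) = 0 \<Longrightarrow> y = 0"
  shows "col_space U' = (*v) (R ** transpose R) ` col_space U"
proof -
  define X where "X = transpose U ** R"
  obtain A where A: "is_arg_min (\<lambda>B. (norm (R - B ** X))\<^sup>2) (\<lambda>_. True) A" "U' = gram_schmidt A"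
    using assms(1) by (auto simp: ls_step_def X_def Let_def)
  have eq: "A ** (X ** transpose X) = (R ** transpose R) ** U"
    using least_squares_normal_equation[OF A(1)]
    by (simp add: X_def matrix_transpose_mul matrix_mul_assoc)
  \<comment> \<open>A vector killed by the Gram matrix is already killed by \<open>X\<^sup>T = R\<^sup>T U\<close>, hence by \<open>R R\<^sup>T U\<close>.\<close>
  have "y = 0" if "(X ** transpose X) *v y = 0" for y
  proof -
    have "(transpose X *v y) \<bullet> (transpose X *v y) = y \<bullet> ((X ** transpose X) *v y)"
      by (simp add: dot_lmul_matrix flip: matrix_vector_mul_assoc)
    then have "transpose X *v y = 0"
      unfolding that by simp
    then have "R *v (transpose X *v y) = 0" by simp
    then have "(R ** transpose R) *v (U *v y) = 0"
      by (simp only: X_def matrix_transpose_mul matrix_vector_mul_assoc transpose_transpose matrix_mul_assoc)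
    then show ?thesis by (rule nz)
  qed
  then have "inj ((*v) (X ** transpose X))"
    by (subst linear_injective_0) auto
  then have "surj ((*v) (X ** transpose X))"
    by (intro linear_injective_imp_surjective) auto
  then have "range ((*v) A) = (*v) A ` range ((*v) (X ** transpose X))"
    by simp
  also have "\<dots> = range ((*v) ((R ** transpose R) ** U))"
    by (simp add: image_image matrix_vector_mul_assoc eq)
  also have "\<dots> = (*v) (R ** transpose R) ` range ((*v) U)"
    by (simp add: image_image matrix_vector_mul_assoc)
  finally show ?thesis
    by (simp only: A(2) col_space_gram_schmidt col_space_eq_range[of A] col_space_eq_range[of U])
qed

section \<open>Principal components and the dominant eigenspace\<close>

text \<open>
  The objective in the definition of principal components is the quadratic form of \<open>R R\<^sup>T\<close>.
\<close>

lemma principal_objective_eq: "(norm (w v* R))\<^sup>2 = w \<bullet> ((R ** transpose R) *v w)"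
  for R :: "real^'n^'p"
  by (simp add: power2_norm_eq_inner dot_lmul_matrix flip: matrix_vector_mul_assoc)

definition orthonormal_eigenbasis :: "real^'p^'p \<Rightarrow> (real^'p) set \<Rightarrow> (real^'p \<Rightarrow> real) \<Rightarrow> bool" where
  "orthonormal_eigenbasis M B \<mu> \<longleftrightarrow>
     finite B \<and> pairwise orthogonal B \<and> span B = UNIV \<and>
     (\<forall>e\<in>B. norm e = 1 \<and> M *v e = \<mu> e *\<^sub>R e)"

lemma orthogonal_eigenspaces:
  assumes sym: "transpose M = M" and "\<mu> \<noteq> \<nu>" and "x \<in> eigenspace M \<mu>" "y \<in> eigenspace M \<nu>"
  shows "orthogonal x y"
proof -
  have "(M *v x) \<bullet> y = x \<bullet> (M *v y)"
    by (metis dot_lmul_matrix sym transpose_matrix_vector)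
  then have "(\<mu> - \<nu>) * (x \<bullet> y) = 0"
    using assms by (simp add: eigenspace_def algebra_simps)
  then show ?thesis using \<open>\<mu> \<noteq> \<nu>\<close> by (simp add: orthogonal_def)
qed

text \<open>
  Since the multiplicities of the singular values are the dimensions of the eigenspaces and add up
  to \<open>p\<close>, orthonormal bases of the eigenspaces together form a basis of the whole space; here the
  spectral theorem is part of the hypothesis. The last property says that the eigenvalues on the
  basis are the squared singular values, with multiplicity.
\<close>

lemma singular_values_eigenbasis:
  fixes R :: "real^'n^'p"
  assumes "has_singular_values R \<sigma>"
  obtains B \<mu> where
    "orthonormal_eigenbasis (R ** transpose R) B \<mu>"
    "\<And>e. e \<in> B \<Longrightarrow> \<exists>i\<in>{1..CARD('p)}. \<mu> e = (\<sigma> i)\<^sup>2"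
    "\<And>P. card {e\<in>B. P (\<mu> e)} = card {i\<in>{1..CARD('p)}. P ((\<sigma> i)\<^sup>2)}"
proof -
  define M where "M = R ** transpose R"
  define I where "I = {1..CARD('p)}"
  \<comment> \<open>The multiplicities are summed over the set of distinct eigenvalues.\<close>
  define L where "L = (\<lambda>i. (\<sigma> i)\<^sup>2) ` I"
  define \<mu> where "\<mu> = (\<lambda>e. e \<bullet> (M *v e))"
  have fin: "finite I" "finite L" by (auto simp: I_def L_def)
  have sym: "transpose M = M" by (simp add: M_def matrix_transpose_mul)
  have dim: "dim (eigenspace M \<nu>) = card {i \<in> I. (\<sigma> i)\<^sup>2 = \<nu>}" for \<nu>
    using assms by (simp add: has_singular_values_def M_def I_def)
  have "subspace (eigenspace M \<nu>)" for \<nu>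
    by (auto simp: subspace_def eigenspace_def algebra_simps matrix_vector_mult_scaleR)
  then have "\<exists>B. B \<subseteq> eigenspace M \<nu> \<and> pairwise orthogonal B \<and> (\<forall>x\<in>B. norm x = 1) \<and>
      independent B \<and> card B = dim (eigenspace M \<nu>)" for \<nu>
    using orthonormal_basis_subspace[of "eigenspace M \<nu>"] by metis
  then obtain b where b: "\<And>\<nu>. b \<nu> \<subseteq> eigenspace M \<nu>" "\<And>\<nu>. pairwise orthogonal (b \<nu>)"
    "\<And>\<nu> x. x \<in> b \<nu> \<Longrightarrow> norm x = 1" "\<And>\<nu>. independent (b \<nu>)"
    "\<And>\<nu>. card (b \<nu>) = dim (eigenspace M \<nu>)"
    by metis
  define B where "B = (\<Union>\<nu>\<in>L. b \<nu>)"
  have finb: "finite (b \<nu>)" for \<nu> using b(4) by (rule independent_imp_finite)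
  have mu: "M *v e = \<nu> *\<^sub>R e \<and> \<mu> e = \<nu>" if "e \<in> b \<nu>" for e \<nu>
  proof -
    have "M *v e = \<nu> *\<^sub>R e" using that b(1) by (auto simp: eigenspace_def)
    moreover have "e \<bullet> e = 1" using b(3)[OF that] by (simp add: norm_eq_1)
    ultimately show ?thesis by (simp add: \<mu>_def)
  qed
  have disj: "b \<nu> \<inter> b \<nu>' = {}" if "\<nu> \<noteq> \<nu>'" for \<nu> \<nu>'
    using mu that by blast
  have card: "card {e\<in>B. P (\<mu> e)} = card {i\<in>I. P ((\<sigma> i)\<^sup>2)}" for P
  proof -
    have "{e\<in>B. P (\<mu> e)} = (\<Union>\<nu>\<in>{\<nu>\<in>L. P \<nu>}. b \<nu>)"
      using mu by (auto simp: B_def)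
    then have "card {e\<in>B. P (\<mu> e)} = (\<Sum>\<nu>\<in>{\<nu>\<in>L. P \<nu>}. card (b \<nu>))"
      using fin finb disj by (simp add: card_UN_disjoint)
    also have "\<dots> = (\<Sum>\<nu>\<in>{\<nu>\<in>L. P \<nu>}. card {i \<in> I. (\<sigma> i)\<^sup>2 = \<nu>})"
      by (simp add: b(5) dim)
    also have "\<dots> = card (\<Union>\<nu>\<in>{\<nu>\<in>L. P \<nu>}. {i \<in> I. (\<sigma> i)\<^sup>2 = \<nu>})"
      using fin by (subst card_UN_disjoint) auto
    also have "(\<Union>\<nu>\<in>{\<nu>\<in>L. P \<nu>}. {i \<in> I. (\<sigma> i)\<^sup>2 = \<nu>}) = {i\<in>I. P ((\<sigma> i)\<^sup>2)}"
      by (auto simp: L_def)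
    finally show ?thesis .
  qed
  have orth: "pairwise orthogonal B"
    unfolding pairwise_def
  proof (intro ballI impI)
    fix x y assume "x \<in> B" "y \<in> B" "x \<noteq> y"
    then obtain \<nu> \<nu>' where xy: "x \<in> b \<nu>" "y \<in> b \<nu>'" by (auto simp: B_def)
    show "orthogonal x y"
    proof (cases "\<nu> = \<nu>'")
      case True
      then show ?thesis using xy b(2)[of \<nu>] \<open>x \<noteq> y\<close> by (auto simp: pairwise_def)
    next
      case False
      then show ?thesis using xy b(1) orthogonal_eigenspaces[OF sym] by blast
    qed
  qed
  have norm: "norm e = 1" if "e \<in> B" for e using that b(3) by (auto simp: B_def)
  have "independent B"
    using orth norm[of 0] by (intro pairwise_orthogonal_independent) auto
  moreover have "card B = CARD('p)"
    using card[of "\<lambda>_. True"] by (simp add: I_def del: atLeastAtMost_iff)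
  ultimately have "span B = UNIV"
    by (metis dim_UNIV DIM_cart DIM_real dim_eq_card_independent dim_eq_full mult.right_neutral)
  moreover have "finite B" using fin finb by (simp add: B_def)
  moreover have "\<exists>i\<in>I. \<mu> e = (\<sigma> i)\<^sup>2" "M *v e = \<mu> e *\<^sub>R e" if "e \<in> B" for e
    using mu that by (auto simp: B_def L_def)
  ultimately show ?thesis
    using orth norm card unfolding I_def M_def
    by (intro that[of B \<mu>]) (simp_all add: orthonormal_eigenbasis_def)
qed

lemma eigenbasis_expansions:
  assumes "orthonormal_eigenbasis M B \<mu>"
  shows eigenbasis_expand: "x = (\<Sum>e\<in>B. (x \<bullet> e) *\<^sub>R e)"
    and eigenbasis_norm: "(norm x)\<^sup>2 = (\<Sum>e\<in>B. (x \<bullet> e)\<^sup>2)"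
    and eigenbasis_norm_apply: "(norm (M *v x))\<^sup>2 = (\<Sum>e\<in>B. (\<mu> e)\<^sup>2 * (x \<bullet> e)\<^sup>2)"
    and eigenbasis_form: "x \<bullet> (M *v x) = (\<Sum>e\<in>B. \<mu> e * (x \<bullet> e)\<^sup>2)"
proof -
  note B = assms[unfolded orthonormal_eigenbasis_def]
  have nn: "norm e = 1" "M *v e = \<mu> e *\<^sub>R e" if "e \<in> B" for e using B that by auto
  show x: "x = (\<Sum>e\<in>B. (x \<bullet> e) *\<^sub>R e)"
    using B by (intro orthonormal_basis_expand[symmetric]) auto
  have sq: "(norm (\<Sum>e\<in>B. c e *\<^sub>R e))\<^sup>2 = (\<Sum>e\<in>B. (c e)\<^sup>2)" for c
    using B by (subst norm_sum_Pythagorean)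
      (auto simp: pairwise_def orthogonal_def power_mult_distrib intro!: sum.cong)
  show "(norm x)\<^sup>2 = (\<Sum>e\<in>B. (x \<bullet> e)\<^sup>2)"
    by (subst x) (rule sq)
  have "M *v x = (\<Sum>e\<in>B. M *v ((x \<bullet> e) *\<^sub>R e))"
    by (subst x) (rule linear_sum, simp)
  also have "\<dots> = (\<Sum>e\<in>B. (\<mu> e * (x \<bullet> e)) *\<^sub>R e)"
    by (intro sum.cong) (auto simp: matrix_vector_mult_scaleR nn)
  finally have Mx: "M *v x = (\<Sum>e\<in>B. (\<mu> e * (x \<bullet> e)) *\<^sub>R e)" .
  show "(norm (M *v x))\<^sup>2 = (\<Sum>e\<in>B. (\<mu> e)\<^sup>2 * (x \<bullet> e)\<^sup>2)"
    by (simp add: Mx sq power_mult_distrib)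
  show "x \<bullet> (M *v x) = (\<Sum>e\<in>B. \<mu> e * (x \<bullet> e)\<^sup>2)"
    by (simp add: Mx inner_sum_right power2_eq_square mult_ac)
qed

lemma eigenbasis_inner_eq_0:
  assumes "orthonormal_eigenbasis M B \<mu>" "x \<in> span {e\<in>B. P (\<mu> e)}" "e \<in> B" "\<not> P (\<mu> e)"
  shows "x \<bullet> e = 0"
proof -
  have "orthogonal e y" if "y \<in> {e\<in>B. P (\<mu> e)}" for y
    using assms that by (auto simp: orthonormal_eigenbasis_def pairwise_def)
  then have "orthogonal e x"
    using orthogonal_to_span[OF assms(2)] by blast
  then show ?thesis by (simp add: orthogonal_def inner_commute)
qed

lemma eigenbasis_dim:
  assumes "orthonormal_eigenbasis M B \<mu>"
  shows "dim (span {e\<in>B. P (\<mu> e)}) = card {e\<in>B. P (\<mu> e)}"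
proof -
  have "independent {e\<in>B. P (\<mu> e)}"
    using assms by (intro pairwise_orthogonal_independent)
      (auto simp: orthonormal_eigenbasis_def pairwise_def)
  then show ?thesis by (rule dim_span_eq_card_independent)
qed

text \<open>
  A vector in the dominant space has coordinates only along eigenvectors with \<open>a \<le> \<mu> e\<close>, a vector
  orthogonal to it only along the others, so both bounds hold coordinate by coordinate.
\<close>

lemma dominant_eigenspace_lower_bound:
  assumes B: "orthonormal_eigenbasis M B \<mu>" and x: "x \<in> span {e\<in>B. a \<le> \<mu> e}" and "0 \<le> a"
  shows "a * norm x \<le> norm (M *v x)"
proof (rule power2_le_imp_le)
  have "a\<^sup>2 * (x \<bullet> e)\<^sup>2 \<le> (\<mu> e)\<^sup>2 * (x \<bullet> e)\<^sup>2" if "e \<in> B" for e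
    using eigenbasis_inner_eq_0[OF B x that] \<open>0 \<le> a\<close>
    by (cases "a \<le> \<mu> e") (auto intro!: mult_right_mono power_mono)
  then show "(a * norm x)\<^sup>2 \<le> (norm (M *v x))\<^sup>2"
    by (simp add: power_mult_distrib eigenbasis_norm[OF B, of x] eigenbasis_norm_apply[OF B]
        sum_distrib_left sum_mono)
qed simp

lemma recessive_eigenspace_upper_bound:
  assumes B: "orthonormal_eigenbasis M B \<mu>" and x: "\<And>z. z \<in> span {e\<in>B. a \<le> \<mu> e} \<Longrightarrow> x \<bullet> z = 0"
    and gap: "\<And>e. e \<in> B \<Longrightarrow> 0 \<le> \<mu> e \<and> (a \<le> \<mu> e \<or> \<mu> e \<le> b)" and "0 \<le> b"
  shows "norm (M *v x) \<le> b * norm x"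
proof (rule power2_le_imp_le)
  have "(\<mu> e)\<^sup>2 * (x \<bullet> e)\<^sup>2 \<le> b\<^sup>2 * (x \<bullet> e)\<^sup>2" if "e \<in> B" for e
  proof (cases "a \<le> \<mu> e")
    case True
    then show ?thesis using x[of e] that by (simp add: span_base)
  next
    case False
    then show ?thesis using gap[OF that] by (intro mult_right_mono power_mono) auto
  qed
  then show "(norm (M *v x))\<^sup>2 \<le> (b * norm x)\<^sup>2"
    by (simp add: power_mult_distrib eigenbasis_norm[OF B, of x] eigenbasis_norm_apply[OF B]
        sum_distrib_left sum_mono)
qed (use \<open>0 \<le> b\<close> in simp)

text \<open>
  The greedy choice of a principal component never leaves the dominant space \<open>F\<close>, as long as the
  constraint space \<open>T\<close> lies in \<open>F\<close> and does not exhaust it. Some direction of \<open>F\<close> is then still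
  admissible, so the maximum is at least \<open>a\<close>. The component \<open>f\<close> of the maximizer \<open>w\<close> in \<open>F\<close> is
  admissible as well, because the rest of \<open>w\<close> is orthogonal to \<open>F\<close> and thus to \<open>T\<close>. If that rest
  had squared norm \<open>r > 0\<close>, it would contribute to the quadratic form at most \<open>b\<close> per unit of
  squared norm, strictly below the maximum, while \<open>f\<close> contributes at most the maximum per unit; so
  the value at \<open>w\<close> would fall short of the maximum.
\<close>

lemma constrained_maximizer_in_dominant_eigenspace:
  assumes B: "orthonormal_eigenbasis M B \<mu>"
    and gap: "\<And>e. e \<in> B \<Longrightarrow> a \<le> \<mu> e \<or> \<mu> e \<le> b" and "b < a"
    and F: "F = span {e\<in>B. a \<le> \<mu> e}"
    and T: "subspace T" "T \<subseteq> F" "dim T < dim F"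
    and max: "is_arg_max (\<lambda>w. w \<bullet> (M *v w)) (\<lambda>w. norm w = 1 \<and> (\<forall>v\<in>T. orthogonal w v)) w"
  shows "w \<in> F"
proof -
  define q where "q = (\<lambda>w. w \<bullet> (M *v w))"
  define H where "H = {e\<in>B. a \<le> \<mu> e}"
  define f where "f = (\<Sum>e\<in>H. (w \<bullet> e) *\<^sub>R e)"
  have FH: "F = span H" by (simp add: F H_def)
  have fin: "finite B" "H \<subseteq> B" using B by (auto simp: orthonormal_eigenbasis_def H_def)
  have w: "norm w = 1" "\<And>v. v \<in> T \<Longrightarrow> w \<bullet> v = 0"
    using max by (auto simp: is_arg_max_linorder orthogonal_def)
  \<comment> \<open>Maximality on the unit sphere, made homogeneous.\<close>
  have best: "q u \<le> q w * (norm u)\<^sup>2" if "\<And>v. v \<in> T \<Longrightarrow> u \<bullet> v = 0" for u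
  proof (cases "u = 0")
    case False
    define u' where "u' = u /\<^sub>R norm u"
    have "norm u' = 1" "\<forall>v\<in>T. orthogonal u' v"
      using that False by (auto simp: u'_def orthogonal_def)
    then have "q u' \<le> q w"
      using max unfolding is_arg_max_linorder q_def by blast
    moreover have "q u' = q u / (norm u)\<^sup>2"
      by (simp add: q_def u'_def matrix_vector_mult_scaleR power2_eq_square divide_inverse)
    ultimately show ?thesis
      using False by (simp add: pos_divide_le_eq)
  qed (simp add: q_def)
  have f_in: "f \<in> F" unfolding f_def FH by (intro span_sum span_mul span_base)
  have fe: "f \<bullet> e = (if e \<in> H then w \<bullet> e else 0)" if "e \<in> B" for e
  proof -
    have "f \<bullet> e = (\<Sum>e'\<in>H. (w \<bullet> e') * (e' \<bullet> e))" by (simp add: f_def inner_sum_left)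
    also have "\<dots> = (\<Sum>e'\<in>H. if e' = e then w \<bullet> e else 0)"
    proof (intro sum.cong refl)
      fix e' assume "e' \<in> H"
      then have "e' \<in> B" using fin by auto
      then show "(w \<bullet> e') * (e' \<bullet> e) = (if e' = e then w \<bullet> e else 0)"
        using B that by (auto simp: orthonormal_eigenbasis_def pairwise_def orthogonal_def norm_eq_1)
    qed
    also have "\<dots> = (if e \<in> H then w \<bullet> e else 0)"
      using finite_subset[OF fin(2,1)] by simp
    finally show ?thesis .
  qed
  obtain u where u: "u \<in> F" "\<And>v. v \<in> T \<Longrightarrow> orthogonal v u" "u \<noteq> 0"
  proof -
    have "dim {y \<in> F. \<forall>x\<in>T. orthogonal x y} + dim T = dim F"
      using T by (intro dim_subspace_orthogonal_to_vectors) (auto simp: F)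
    then have "dim {y \<in> F. \<forall>x\<in>T. orthogonal x y} \<noteq> 0" using T by linarith
    then show ?thesis using that unfolding dim_eq_0 by blast
  qed
  have "a * (norm u)\<^sup>2 \<le> q u"
  proof -
    have "a * (u \<bullet> e)\<^sup>2 \<le> \<mu> e * (u \<bullet> e)\<^sup>2" if "e \<in> B" for e
      using eigenbasis_inner_eq_0[OF B _ that] u(1)
      by (cases "a \<le> \<mu> e") (auto simp: F intro!: mult_right_mono)
    then show ?thesis
      by (simp add: q_def eigenbasis_norm[OF B] eigenbasis_form[OF B] sum_distrib_left sum_mono)
  qed
  also have "\<dots> \<le> q w * (norm u)\<^sup>2"
    using u(2) by (intro best) (simp add: orthogonal_def inner_commute)
  finally have "a \<le> q w" using u(3) by simp
  have f_orth: "f \<bullet> v = 0" if "v \<in> T" for v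
  proof -
    have "v = (\<Sum>e\<in>B. (v \<bullet> e) *\<^sub>R e)" by (rule eigenbasis_expand[OF B])
    then have "f \<bullet> v = (\<Sum>e\<in>B. (v \<bullet> e) * (f \<bullet> e))"
      by (metis (no_types, lifting) inner_scaleR_right inner_sum_right sum.cong)
    also have "\<dots> = (\<Sum>e\<in>B. (v \<bullet> e) * (w \<bullet> e))"
    proof (intro sum.cong refl)
      fix e assume e: "e \<in> B"
      show "(v \<bullet> e) * (f \<bullet> e) = (v \<bullet> e) * (w \<bullet> e)"
        using eigenbasis_inner_eq_0[OF B _ e, of v "\<lambda>t. a \<le> t"] that T(2) e
        by (auto simp: fe H_def F)
    qed
    also have "\<dots> = w \<bullet> v"
      by (subst (2) eigenbasis_expand[OF B, of v]) (simp add: inner_sum_right)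
    finally show ?thesis using w(2)[OF that] by simp
  qed
  define r where "r = (\<Sum>e\<in>B - H. (w \<bullet> e)\<^sup>2)"
  have split: "sum g B = sum g H + sum g (B - H)" for g :: "real^'a \<Rightarrow> real"
    using fin by (metis add.commute sum.subset_diff)
  have normf: "(norm f)\<^sup>2 = (\<Sum>e\<in>H. (w \<bullet> e)\<^sup>2)"
    using fin by (simp add: eigenbasis_norm[OF B, of f] split fe subset_eq)
  have qf: "q f = (\<Sum>e\<in>H. \<mu> e * (w \<bullet> e)\<^sup>2)"
    using fin by (simp add: q_def eigenbasis_form[OF B, of f] split fe subset_eq)
  have "(norm w)\<^sup>2 = (norm f)\<^sup>2 + r"
    by (simp add: eigenbasis_norm[OF B, of w] split normf r_def)
  then have one: "(norm f)\<^sup>2 = 1 - r" by (simp add: w)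
  have "q w = q f + (\<Sum>e\<in>B - H. \<mu> e * (w \<bullet> e)\<^sup>2)"
    unfolding qf unfolding q_def eigenbasis_form[OF B] by (rule split)
  also have "\<dots> \<le> q w * (1 - r) + b * r"
  proof (intro add_mono)
    show "q f \<le> q w * (1 - r)" using best[OF f_orth] by (simp add: one)
    show "(\<Sum>e\<in>B - H. \<mu> e * (w \<bullet> e)\<^sup>2) \<le> b * r"
      unfolding r_def sum_distrib_left
      using gap by (intro sum_mono mult_right_mono) (auto simp: H_def)
  qed
  finally have "(q w - b) * r \<le> 0" by (simp add: algebra_simps)
  moreover have "r \<ge> 0" by (simp add: r_def sum_nonneg)
  ultimately have "r = 0"
    using \<open>a \<le> q w\<close> \<open>b < a\<close> by (auto simp: mult_le_0_iff)
  then have "w \<bullet> e = 0" if "e \<in> B - H" for e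
    using that fin unfolding r_def by (subst (asm) sum_nonneg_eq_0_iff) auto
  then have "w = f"
    unfolding f_def using fin
    by (subst eigenbasis_expand[OF B, of w]) (intro sum.mono_neutral_right, auto)
  then show ?thesis using f_in by simp
qed

lemma columns_leading_pcs:
  fixes W :: "real^('d::{finite,linorder})^'p"
  assumes "leading_pcs R W"
  shows norm_column_leading_pcs: "norm (column i W) = 1"
    and orthogonal_columns_leading_pcs: "i \<noteq> j \<Longrightarrow> orthogonal (column i W) (column j W)"
proof -
  have *: "norm (column i W) = 1" "\<And>j. j < i \<Longrightarrow> orthogonal (column i W) (column j W)" for i
    using assms by (auto simp: leading_pcs_def is_arg_max_def intro: span_base)
  show "norm (column i W) = 1" by (rule *)
  show "orthogonal (column i W) (column j W)" if "i \<noteq> j"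
    using that *(2)[of i j] *(2)[of j i] by (auto simp: neq_iff orthogonal_commute)
qed

lemma dim_col_space_leading_pcs:
  fixes W :: "real^('d::{finite,linorder})^'p"
  assumes W: "leading_pcs R W"
  shows "dim (col_space W) = CARD('d)"
proof -
  have cols: "columns W = range (\<lambda>i. column i W)" by (auto simp: columns_def)
  have "inj (\<lambda>i. column i W)"
    using norm_column_leading_pcs[OF W] orthogonal_columns_leading_pcs[OF W]
    unfolding inj_def by (metis norm_zero orthogonal_self zero_neq_one)
  then have "card (columns W) = CARD('d)" by (simp add: cols card_image)
  moreover have "independent (columns W)"
  proof (rule pairwise_orthogonal_independent)
    show "pairwise orthogonal (columns W)"
      unfolding cols pairwise_def
    proof (intro ballI impI)
      fix x y assume "x \<in> range (\<lambda>i. column i W)" "y \<in> range (\<lambda>i. column i W)" "x \<noteq> y"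
      then obtain i j where "x = column i W" "y = column j W" "i \<noteq> j" by auto
      then show "orthogonal x y" using orthogonal_columns_leading_pcs[OF W, of i j] by simp
    qed
    show "0 \<notin> columns W"
    proof
      assume "0 \<in> columns W"
      then obtain i where "column i W = 0" by (auto simp: cols)
      then show False using norm_column_leading_pcs[OF W, of i] by simp
    qed
  qed
  ultimately show ?thesis
    by (simp add: col_space_def dim_eq_card_independent)
qed

text \<open>
  By induction all leading principal components lie in the dominant space, which has the dimension
  of their span. This holds for every choice of components, also when some of the \<open>d\<close> largest
  eigenvalues coincide.
\<close>

lemma col_space_leading_pcs:
  fixes R :: "real^'n^'p" and W :: "real^('d::{finite,linorder})^'p"
  assumes W: "leading_pcs R W" and B: "orthonormal_eigenbasis (R ** transpose R) B \<mu>"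
    and gap: "\<And>e. e \<in> B \<Longrightarrow> a \<le> \<mu> e \<or> \<mu> e \<le> b" and "b < a"
    and card: "card {e\<in>B. a \<le> \<mu> e} = CARD('d)"
  shows "col_space W = span {e\<in>B. a \<le> \<mu> e}"
proof (rule subspace_dim_equal)
  define F where "F = span {e\<in>B. a \<le> \<mu> e}"
  have dimF: "dim F = CARD('d)" using eigenbasis_dim[OF B] card by (simp add: F_def)
  have "column i W \<in> F" for i
  proof (induction i rule: finite_linorder_less_induct)
    case (1 i)
    define T where "T = span {column j W |j. j < i}"
    show ?case
    proof (rule constrained_maximizer_in_dominant_eigenspace[OF B gap \<open>b < a\<close> F_def])
      show "subspace T" by (simp add: T_def)
      show "T \<subseteq> F" unfolding T_def using 1 by (intro span_minimal) (auto simp: F_def)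
      have "{column j W |j. j < i} = (\<lambda>j. column j W) ` {j. j < i}" by auto
      then have "dim T \<le> card ((\<lambda>j. column j W) ` {j. j < i})"
        unfolding T_def by (intro dim_le_card) auto
      also have "\<dots> \<le> card {j. j < i}" by (intro card_image_le) simp
      also have "\<dots> < CARD('d)" by (intro psubset_card_mono) auto
      finally show "dim T < dim F" by (simp add: dimF)
      show "is_arg_max (\<lambda>w. w \<bullet> (R ** transpose R *v w))
          (\<lambda>w. norm w = 1 \<and> (\<forall>v\<in>T. orthogonal w v)) (column i W)"
        using W by (simp add: leading_pcs_def T_def principal_objective_eq)
    qed
  qed
  then show "col_space W \<subseteq> span {e\<in>B. a \<le> \<mu> e}"
    unfolding col_space_def F_def[symmetric] by (intro span_minimal) (auto simp: columns_def F_def)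
  show "dim (span {e\<in>B. a \<le> \<mu> e}) \<le> dim (col_space W)"
    using dimF by (simp add: dim_col_space_leading_pcs[OF W] F_def)
qed (simp_all add: col_space_def)

section \<open>Convergence of the iteration\<close>

lemma singular_values_gap:
  fixes R :: "real^'n^'p"
  assumes \<sigma>: "has_singular_values R \<sigma>" and d: "1 \<le> d" "d < CARD('p)" and gap: "\<sigma> (d + 1) < \<sigma> d"
  shows "\<And>i. i \<in> {1..CARD('p)} \<Longrightarrow> i \<le> d \<Longrightarrow> (\<sigma> d)\<^sup>2 \<le> (\<sigma> i)\<^sup>2"
    and "\<And>i. i \<in> {1..CARD('p)} \<Longrightarrow> d < i \<Longrightarrow> (\<sigma> i)\<^sup>2 \<le> (\<sigma> (d + 1))\<^sup>2"
    and "(\<sigma> (d + 1))\<^sup>2 < (\<sigma> d)\<^sup>2"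
proof -
  have anti: "\<sigma> j \<le> \<sigma> i" if "i \<in> {1..CARD('p)}" "j \<in> {1..CARD('p)}" "i \<le> j" for i j
    using \<sigma> that by (auto simp: has_singular_values_def monotone_on_def)
  have nn: "0 \<le> \<sigma> i" if "i \<in> {1..CARD('p)}" for i
    using \<sigma> that by (simp add: has_singular_values_def)
  show "(\<sigma> d)\<^sup>2 \<le> (\<sigma> i)\<^sup>2" if "i \<in> {1..CARD('p)}" "i \<le> d" for i
    using that d by (intro power_mono anti nn) auto
  show "(\<sigma> i)\<^sup>2 \<le> (\<sigma> (d + 1))\<^sup>2" if "i \<in> {1..CARD('p)}" "d < i" for i
    using that d by (intro power_mono anti nn) auto
  show "(\<sigma> (d + 1))\<^sup>2 < (\<sigma> d)\<^sup>2"
    using gap d by (intro power_strict_mono nn) auto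
qed

text \<open>
  All that the iteration has to know about principal components and singular values: their span is
  invariant under \<open>R R\<^sup>T\<close>, which stretches by at least \<open>\<sigma>\<^sub>d\<^sup>2\<close> inside it and by at most
  \<open>\<sigma>\<^sub>d\<^sub>+\<^sub>1\<^sup>2\<close> orthogonally to it.
\<close>

lemma leading_pcs_spectral_gap:
  fixes R :: "real^'n^'p" and W :: "real^('d::{finite,linorder})^'p"
  assumes d: "CARD('d) < CARD('p)" and \<sigma>: "has_singular_values R \<sigma>"
    and gap: "\<sigma> (CARD('d) + 1) < \<sigma> CARD('d)" and W: "leading_pcs R W"
  defines "M \<equiv> R ** transpose R"
  shows "\<And>x. x \<in> col_space W \<Longrightarrow> (\<sigma> CARD('d))\<^sup>2 * norm x \<le> norm (M *v x)"
    and "\<And>x. (\<And>z. z \<in> col_space W \<Longrightarrow> x \<bullet> z = 0) \<Longrightarrow> norm (M *v x) \<le> (\<sigma> (CARD('d) + 1))\<^sup>2 * norm x"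
    and "(*v) M ` col_space W \<subseteq> col_space W"
proof -
  define a where "a = (\<sigma> CARD('d))\<^sup>2"
  define b where "b = (\<sigma> (CARD('d) + 1))\<^sup>2"
  have "1 \<le> CARD('d)" by (simp add: Suc_leI)
  note sq = singular_values_gap[OF \<sigma> this d gap, folded a_def b_def]
  obtain B \<mu> where B: "orthonormal_eigenbasis M B \<mu>"
    and \<mu>: "\<And>e. e \<in> B \<Longrightarrow> \<exists>i\<in>{1..CARD('p)}. \<mu> e = (\<sigma> i)\<^sup>2"
    and card: "\<And>P. card {e\<in>B. P (\<mu> e)} = card {i\<in>{1..CARD('p)}. P ((\<sigma> i)\<^sup>2)}"
    using singular_values_eigenbasis[OF \<sigma>] unfolding M_def by blast
  have ab: "0 \<le> \<mu> e \<and> (a \<le> \<mu> e \<or> \<mu> e \<le> b)" if "e \<in> B" for e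
  proof -
    obtain i where "i \<in> {1..CARD('p)}" "\<mu> e = (\<sigma> i)\<^sup>2" using \<mu> \<open>e \<in> B\<close> by blast
    then show ?thesis using sq(1,2)[of i] by (cases "i \<le> CARD('d)") auto
  qed
  have "{i\<in>{1..CARD('p)}. a \<le> (\<sigma> i)\<^sup>2} = {1..CARD('d)}"
    using sq d by (fastforce simp: not_le[symmetric])
  then have "card {e\<in>B. a \<le> \<mu> e} = CARD('d)"
    using card[of "\<lambda>t. a \<le> t"] by simp
  then have S: "col_space W = span {e\<in>B. a \<le> \<mu> e}"
    using ab B sq(3) by (intro col_space_leading_pcs[OF W, of B \<mu> a b]) (auto simp: M_def)
  show "(\<sigma> CARD('d))\<^sup>2 * norm x \<le> norm (M *v x)" if "x \<in> col_space W" for x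
    using dominant_eigenspace_lower_bound[OF B, of x a] that by (simp add: S a_def)
  show "norm (M *v x) \<le> (\<sigma> (CARD('d) + 1))\<^sup>2 * norm x"
    if "\<And>z. z \<in> col_space W \<Longrightarrow> x \<bullet> z = 0" for x
    using recessive_eigenspace_upper_bound[OF B, of a x b] that ab by (simp add: S b_def)
  show "(*v) M ` col_space W \<subseteq> col_space W"
  proof -
    have "(*v) M ` {e\<in>B. a \<le> \<mu> e} \<subseteq> span {e\<in>B. a \<le> \<mu> e}"
      using B by (auto simp: orthonormal_eigenbasis_def intro: span_mul span_base)
    then have "span ((*v) M ` {e\<in>B. a \<le> \<mu> e}) \<subseteq> span {e\<in>B. a \<le> \<mu> e}"
      by (intro span_minimal) auto
    then show ?thesis by (simp add: S linear_span_image)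
  qed
qed

text \<open>
  Full rank of \<open>U\<^sup>T W\<close> makes the square matrix \<open>W\<^sup>T U\<close> injective. Hence \<open>U\<close> is injective, and a
  vector of its range that is orthogonal to the columns of \<open>W\<close> vanishes.
\<close>

lemma full_rank_overlap:
  fixes U W :: "real^'d^'p"
  assumes "rank (transpose U ** W) = CARD('d)"
  shows "dim (col_space U) = CARD('d)"
    and "v \<in> col_space U \<Longrightarrow> orth_proj (col_space W) v = 0 \<Longrightarrow> v = 0"
proof -
  have "rank (transpose W ** U) = CARD('d)"
    using assms rank_transpose[of "transpose U ** W"] by (simp add: matrix_transpose_mul)
  then have "inj ((*v) (transpose W ** U))" by (simp add: full_rank_injective)
  then have inj: "y = 0" if "transpose W *v (U *v y) = 0" for y
    using that by (subst (asm) linear_injective_0) (auto simp: matrix_vector_mul_assoc)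
  then have "inj ((*v) U)"
    by (subst linear_injective_0) auto
  then show "dim (col_space U) = CARD('d)" by (simp add: inj_iff_dim_col_space)
  assume v: "v \<in> col_space U" "orth_proj (col_space W) v = 0"
  then obtain y where y: "v = U *v y" by (auto simp: col_space_eq_range)
  have "v \<bullet> (W *v z) = 0" for z
    using orth_proj_residual[OF subspace_col_space, of "W *v z" W v] v by (simp add: col_space_eq_range)
  then have "(transpose W *v v) \<bullet> (transpose W *v v) = 0"
    by (simp add: dot_lmul_matrix)
  then show "v = 0" using inj[of y] by (simp add: y)
qed

theorem corollary2:
  fixes R :: "real^'n^'p"
    and \<sigma> :: "nat \<Rightarrow> real"
    and Ud U0 :: "real^('d::{finite,linorder})^'p"
    and U :: "nat \<Rightarrow> real^('d::{finite,linorder})^'p"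
  assumes "CARD('d) < CARD('p)"
    and "CARD('n) > CARD('p)"
    and "has_singular_values R \<sigma>"
    and "\<sigma> CARD('d) > \<sigma> (CARD('d) + 1)"
    and "leading_pcs R Ud"
    and "rank (transpose U0 ** Ud) = CARD('d)"
    and "ls_iterates R U0 U"
  shows "(\<lambda>k. subspace_dist (col_space (U k)) (col_space Ud)) \<longlonglongrightarrow> 0 \<and>
    (\<forall>\<epsilon>>0. (\<lambda>k. subspace_dist (col_space (U k)) (col_space Ud))
       \<in> O(\<lambda>k. ((\<sigma> (CARD('d) + 1))\<^sup>2 / (\<sigma> CARD('d))\<^sup>2 + \<epsilon>) ^ k))"
proof -
  define M where "M = R ** transpose R"
  define a where "a = (\<sigma> CARD('d))\<^sup>2"
  define b where "b = (\<sigma> (CARD('d) + 1))\<^sup>2"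
  define S where "S = col_space Ud"
  define V where "V = (\<lambda>k. col_space (U k))"
  define D where "D = (\<lambda>k. subspace_dist (V k) S)"
  have "1 \<le> CARD('d)" by (simp add: Suc_leI)
  then have "b < a"
    using singular_values_gap(3)[OF assms(3) _ assms(1,4)] by (simp add: a_def b_def)
  moreover have "0 \<le> b" by (simp add: b_def)
  ultimately have "0 < a" and r: "0 \<le> b / a" "b / a < 1" by auto
  have S: "subspace S" and V: "subspace (V k)" for k
    by (simp_all add: S_def V_def subspace_col_space)
  have dimS: "dim S = CARD('d)"
    unfolding S_def by (rule dim_col_space_leading_pcs[OF assms(5)])
  have lo: "\<And>x. x \<in> S \<Longrightarrow> a * norm x \<le> norm (M *v x)"
    and hi: "\<And>x. (\<And>z. z \<in> S \<Longrightarrow> x \<bullet> z = 0) \<Longrightarrow> norm (M *v x) \<le> b * norm x"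
    and inv: "(*v) M ` S \<subseteq> S"
    using leading_pcs_spectral_gap[OF assms(1,3,4,5)] by (auto simp: a_def b_def M_def S_def)
  \<comment> \<open>\<open>S\<close> is invariant under the symmetric matrix \<open>M\<close>, hence so is its complement.\<close>
  have com: "orth_proj S (M *v x) = M *v orth_proj S x" for x
  proof (rule orth_proj_commute[OF S _ inv])
    have "transpose M = M" by (simp add: M_def matrix_transpose_mul)
    then show "(M *v x) \<bullet> y = x \<bullet> (M *v y)" for x y
      by (metis dot_lmul_matrix transpose_matrix_vector)
  qed simp
  have U0: "U 0 = U0" and step: "ls_step R (U k) (U (Suc k))" for k
    using assms(7) by (auto simp: ls_iterates_def)
  obtain c where c: "0 \<le> c" "tilt_le S (V 0) c"
    using ex_tilt_le[OF S V[of 0]] full_rank_overlap(2)[OF assms(6)] by (auto simp: V_def S_def U0)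
  \<comment> \<open>The cone condition also carries the non-degeneracy: it keeps \<open>M\<close> injective on \<open>V k\<close>,
    so the dimension never drops and the next step is again a step of subspace iteration.\<close>
  have main: "dim (V k) = CARD('d) \<and> tilt_le S (V k) (c * (b / a) ^ k)" for k
  proof (induction k)
    case 0
    then show ?case using c full_rank_overlap(1)[OF assms(6)] by (simp add: V_def U0)
  next
    case (Suc k)
    have ker: "v = 0" if "v \<in> V k" "M *v v = 0" for v
    proof -
      have "M *v orth_proj S v = 0"
        using com[of v] that linear_0[OF linear_orth_proj[OF S]] by simp
      then have "orth_proj S v = 0"
        using lo[OF orth_proj_mem[OF S], of v] \<open>0 < a\<close> by (simp add: mult_le_0_iff)
      then show ?thesis using tilt_le_orth_proj_eq_0 Suc that by blast
    qed
    have "inj ((*v) (U k))"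
      using Suc by (simp add: inj_iff_dim_col_space V_def)
    then have inj: "U k *v y = 0 \<Longrightarrow> y = 0" for y
      by (subst (asm) linear_injective_0) auto
    have image: "V (Suc k) = (*v) M ` V k"
      unfolding V_def M_def
    proof (rule col_space_ls_step[OF step])
      fix y assume "R ** transpose R *v (U k *v y) = 0"
      then show "y = 0"
        using ker[of "U k *v y"] inj by (auto simp: V_def M_def col_space_eq_range)
    qed
    have "inj_on ((*v) M) (V k)"
      using ker by (subst linear_inj_on_iff_eq_0[OF _ V]) auto
    then have "dim (V (Suc k)) = dim (V k)"
      unfolding image by (intro dim_image_eq) (simp_all add: span_eq_iff[THEN iffD2, OF V])
    moreover have "tilt_le S (V (Suc k)) (c * (b / a) ^ k * (b / a))"
      unfolding image
      by (rule tilt_le_image[OF S _ com lo hi]) (use Suc \<open>0 < a\<close> \<open>0 \<le> b\<close> c r in auto)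
    ultimately show ?case using Suc by (simp add: mult_ac)
  qed
  have bound: "D k \<le> 2 * c * (b / a) ^ k" for k
    using subspace_dist_le_tilt[OF S V[of k], of "c * (b / a) ^ k"] main[of k] dimS c r
    by (simp add: D_def)
  have nonneg: "0 \<le> D k" for k
    unfolding D_def by (rule subspace_dist_nonneg[OF V S])
  have "(\<lambda>k. 2 * c * (b / a) ^ k) \<longlonglongrightarrow> 2 * c * 0"
    using r by (intro tendsto_intros LIMSEQ_realpow_zero) auto
  then have "D \<longlonglongrightarrow> 0"
    by (intro tendsto_sandwich[of "\<lambda>_. 0" D sequentially "\<lambda>k. 2 * c * (b / a) ^ k"])
      (auto simp: nonneg bound)
  moreover have "D \<in> O(\<lambda>k. (b / a + \<epsilon>) ^ k)" if "\<epsilon> > 0" for \<epsilon>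
  proof (rule bigoI[where c = "2 * c"], intro always_eventually allI)
    fix k
    have "(b / a) ^ k \<le> (b / a + \<epsilon>) ^ k"
      using r that by (intro power_mono) auto
    then have "2 * c * (b / a) ^ k \<le> 2 * c * (b / a + \<epsilon>) ^ k"
      using c by (intro mult_left_mono) auto
    then have "D k \<le> 2 * c * (b / a + \<epsilon>) ^ k"
      using bound[of k] by simp
    moreover have "0 \<le> (b / a + \<epsilon>) ^ k"
      using r that by (intro zero_le_power) simp
    ultimately show "norm (D k) \<le> 2 * c * norm ((b / a + \<epsilon>) ^ k)"
      using nonneg[of k] by simp
  qed
  ultimately show ?thesis
    by (simp add: D_def V_def S_def a_def b_def)
qed

end
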